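(* Let $\nu\in\mathbb{R}$ and let $a=-\sigma$ with $0<\sigma<1$. Let $\mathbf{L}_\nu(z;-\sigma)$ be the generalised Struve function defined in the context. Then, for $z=i|z|$ (that is, $\arg z=\tfrac12\pi$), $$(\tfrac12 i|z|)^{-\nu-1}\,\mathbf{L}_\nu(i|z|;-\sigma)\sim\frac1\pi\sum_{k=0}^\infty\frac{\Gamma(k+\frac12)\,(\frac12|z|)^{-2k-2}}{\Gamma(\nu+\frac32+\sigma(k+1))}$$ as $|z|\to\infty$ (an exponentially small contribution being neglected).
   Context: **Generalised Struve function.** For real $\nu$ and real $a>-1$, $$\mathbf{L}_\nu(z;a)=(\tfrac12 z)^{\nu+1}\sum_{n=0}^\infty\frac{(\frac12 z)^{2n}}{\Gamma(n+\frac32)\,\Gamma(an+\nu+\frac32)},$$ with $1/\Gamma$ equal to $0$ at the poles of $\Gamma$. Hence the left-hand side of the claim equals $\sum_{n\ge0}(-1)^n(\frac12|z|)^{2n}/\{\Gamma(n+\frac32)\Gamma(-\sigma n+\nu+\frac32)\}$. **Meaning of $\sim$.** The relation is an asymptotic expansion in the Poincaré sense: for every positive integer $K$, the difference between the left-hand side and the sum of the terms with $k<K$ on the right-hand side is $O(|z|^{-2K-2})$ as $|z|\to\infty$. *)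

theory Defs
  imports "HOL-Analysis.Analysis" "HOL-Library.Landau_Symbols"
begin

text \<open>
  The generalised Struve function, for real \<open>\<nu>\<close> and real \<open>a > -1\<close> (where the power series
  is entire). The reciprocal Gamma function \<^const>\<open>rGamma\<close> vanishes at the poles of
  \<^const>\<open>Gamma\<close>, and the prefactor takes the principal branch of the power.
\<close>
definition gen_struve :: "real \<Rightarrow> real \<Rightarrow> complex \<Rightarrow> complex" where
  "gen_struve \<nu> a z =
     (z / 2) powr complex_of_real (\<nu> + 1) *
     (\<Sum>n. (z / 2) ^ (2 * n) *
        complex_of_real (rGamma (real n + 3/2) * rGamma (a * real n + \<nu> + 3/2)))"

end

theory Submission
  imports Defs "HOL-Complex_Analysis.Complex_Analysis" "HOL-Real_Asymp.Real_Asymp"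
begin

text \<open>
  Put \<open>x = (r/2)\<^sup>2\<close> and \<open>F b \<mu> x = (\<Sum>n. (- x)^n * rGamma (n + b) * rGamma (\<mu> - \<sigma> n))\<close>; the
  left-hand side is \<open>F (3/2) (\<nu> + 3/2) x\<close>. Splitting off the first term of the series gives
  \<open>F b \<mu> x = (rGamma (b - 1) * rGamma (\<mu> + \<sigma>) - F (b - 1) (\<mu> + \<sigma>) x) / x\<close>, and iterating
  this identity produces the expansion, so it remains to bound \<open>F b \<mu>\<close> on \<open>x \<ge> 0\<close> for every \<open>b\<close>.
  Because \<open>F (b - 1) \<mu>\<close> is a linear combination of \<open>F b \<mu>\<close> and \<open>F b (\<mu> - 1)\<close>, it suffices to
  take \<open>b > 2\<close>. There Hankel's integral for \<open>rGamma (\<mu> - \<sigma> n)\<close>, with the variable replaced by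
  its exponential, turns \<open>F b \<mu> x\<close> into a contour integral of
  \<open>exp (exp z + (1 - \<mu>) z) * E (- x * exp (\<sigma> z))\<close>, where \<open>E w = (\<Sum>n. rGamma (n + b) * w^n)\<close> is
  bounded on the half-plane \<open>Re w \<le> 0\<close>. As \<open>\<sigma> < 1\<close>, the contour can be chosen within
  \<open>\<bar>Im z\<bar> \<le> pi / (2 * \<sigma>)\<close>, where the argument of \<open>E\<close> stays in that half-plane for all \<open>x \<ge> 0\<close>.
\<close>

section \<open>Hankel's integrand in the exponential variable, and increments of its
  primitives\<close>

text \<open>Substituting \<open>t = exp z\<close> in Hankel's integrand, \<open>exp t\<close> times
  the power \<open>- s\<close> of \<open>t\<close>, gives this function, the extra \<open>z\<close>
  in the exponent coming from \<open>dt\<close>. It is entire, and the two sides of the branch cut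
  become the lines \<open>Im z = pi\<close> and \<open>Im z = - pi\<close>.\<close>

definition hankel_fun :: "real \<Rightarrow> complex \<Rightarrow> complex" where
  "hankel_fun s z = exp (exp z + of_real (1 - s) * z)"

lemma norm_hankel_fun: "norm (hankel_fun s z) = exp (exp (Re z) * cos (Im z) + (1 - s) * Re z)"
  by (simp add: hankel_fun_def Re_exp)

lemma continuous_on_hankel_fun [continuous_intros]:
  "continuous_on A f \<Longrightarrow> continuous_on A (\<lambda>x. hankel_fun s (f x))"
  unfolding hankel_fun_def by (intro continuous_intros)

text \<open>With a global primitive \<open>P\<close>, contour integrals become increments of
  \<open>P\<close>, and a deformation of the contour only requires control of increments over
  vertical segments.\<close>

lemma hankel_fun_has_primitive:
  obtains P where "\<And>z. (P has_field_derivative hankel_fun s z) (at z)"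
proof -
  have "hankel_fun s holomorphic_on UNIV"
    unfolding hankel_fun_def by (intro holomorphic_intros)
  then obtain P where "\<And>z. z \<in> UNIV \<Longrightarrow> (P has_field_derivative hankel_fun s z) (at z within UNIV)"
    using holomorphic_convex_primitive' [of UNIV "hankel_fun s"] by (metis convex_UNIV open_UNIV)
  then show ?thesis using that by auto
qed

lemma Complex_has_vector_derivative_Re: "((\<lambda>x. Complex x y) has_vector_derivative 1) (at x within A)"
proof -
  have "((\<lambda>x. of_real x + \<i> * of_real y) has_vector_derivative 1) (at x within A)"
    by (auto intro!: derivative_eq_intros)
  then show ?thesis by (simp add: Complex_eq)
qed

lemma Complex_has_vector_derivative_Im: "((\<lambda>y. Complex x y) has_vector_derivative \<i>) (at y within A)"
proof -
  have "((\<lambda>y. of_real x + \<i> * of_real y) has_vector_derivative \<i>) (at y within A)"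
    by (auto intro!: derivative_eq_intros)
  then show ?thesis by (simp add: Complex_eq)
qed

lemma vector_derivative_horizontal:
  assumes "\<And>z. (P has_field_derivative f z) (at z)"
  shows "((\<lambda>x. P (Complex x y)) has_vector_derivative f (Complex x y)) (at x within A)"
  using field_vector_diff_chain_within [OF Complex_has_vector_derivative_Re, of P _ x y A]
    has_field_derivative_at_within[OF assms] by (fastforce simp: o_def)

lemma vector_derivative_vertical:
  assumes "\<And>z. (P has_field_derivative f z) (at z)"
  shows "((\<lambda>y. P (Complex x y)) has_vector_derivative \<i> * f (Complex x y)) (at y within A)"
  using field_vector_diff_chain_within [OF Complex_has_vector_derivative_Im, of P _ x y A]
    has_field_derivative_at_within[OF assms] by (fastforce simp: o_def)

lemma vertical_increment_bound:
  assumes P: "\<And>z. (P has_field_derivative f z) (at z)"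
    and B: "\<And>y. y \<in> {a..b} \<Longrightarrow> norm (f (Complex x y)) \<le> B" and "a \<le> b"
  shows "norm (P (Complex x b) - P (Complex x a)) \<le> B * (b - a)"
proof -
  let ?S = "closed_segment (Complex x a) (Complex x b)"
  have S: "Re z = x \<and> Im z \<in> {a..b}" if "z \<in> ?S" for z
    using that \<open>a \<le> b\<close> by (auto simp: closed_segment_same_Re closed_segment_eq_real_ivl)
  have "norm (P (Complex x b) - P (Complex x a)) \<le> B * norm (Complex x b - Complex x a)"
    by (rule field_differentiable_bound [where S = ?S and f' = f])
       (use S B in \<open>force intro: has_field_derivative_at_within P simp: complex_eq_iff\<close>)+
  also have "norm (Complex x b - Complex x a) = b - a"
    using \<open>a \<le> b\<close> by (simp add: cmod_def)
  finally show ?thesis .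
qed

text \<open>Where the cosine is at most \<open>- c\<close>, the integrand decays doubly
  exponentially to the right. Hence the ends of a contour at infinity may be moved vertically within
  such heights.\<close>

lemma hankel_primitive_at_top:
  assumes P: "\<And>z. (P has_field_derivative hankel_fun s z) (at z)"
    and c: "c > 0" "\<And>y. y \<in> {a..b} \<Longrightarrow> cos y \<le> - c" and ab: "a \<le> b"
  shows "((\<lambda>x. P (Complex x b) - P (Complex x a)) \<longlongrightarrow> 0) at_top"
proof (rule Lim_null_comparison)
  show "\<forall>\<^sub>F x in at_top. norm (P (Complex x b) - P (Complex x a))
          \<le> exp (- c * exp x + (1 - s) * x) * (b - a)"
  proof (intro always_eventually allI vertical_increment_bound [OF P _ ab])
    fix x y assume "y \<in> {a..b}"
    then have "exp x * cos y \<le> exp x * (- c)"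
      by (intro mult_left_mono c) auto
    then show "norm (hankel_fun s (Complex x y)) \<le> exp (- c * exp x + (1 - s) * x)"
      by (simp add: norm_hankel_fun mult.commute)
  qed
  show "((\<lambda>x. exp (- c * exp x + (1 - s) * x) * (b - a)) \<longlongrightarrow> 0) at_top"
    using c(1) by real_asymp
qed

text \<open>For \<open>s < 1\<close> the factor \<open>exp ((1 - s) * x)\<close> forces decay to the
  left. This fixes the constant of integration when increments across the strip are
  computed.\<close>

lemma hankel_primitive_at_bot:
  assumes P: "\<And>z. (P has_field_derivative hankel_fun s z) (at z)" and s: "s < 1" and ab: "a \<le> b"
  shows "((\<lambda>x. P (Complex x b) - P (Complex x a)) \<longlongrightarrow> 0) at_bot"
proof (rule Lim_null_comparison)
  show "\<forall>\<^sub>F x in at_bot. norm (P (Complex x b) - P (Complex x a))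
          \<le> exp (exp x + (1 - s) * x) * (b - a)"
  proof (intro always_eventually allI vertical_increment_bound [OF P _ ab])
    fix x y assume "y \<in> {a..b}"
    have "exp x * cos y \<le> exp x * 1"
      by (intro mult_left_mono) auto
    then show "norm (hankel_fun s (Complex x y)) \<le> exp (exp x + (1 - s) * x)"
      by (simp add: norm_hankel_fun mult.commute)
  qed
  show "((\<lambda>x. exp (exp x + (1 - s) * x) * (b - a)) \<longlongrightarrow> 0) at_bot"
  proof -
    define k where "k = 1 - s"
    have "k > 0" using s by (simp add: k_def)
    then have "((\<lambda>x. exp (exp x + k * x) * (b - a)) \<longlongrightarrow> 0) at_bot"
      by real_asymp
    then show ?thesis by (simp add: k_def)
  qed
qed

text \<open>At \<open>s = 1\<close> the integrand \<open>exp (exp z)\<close> tends to 1 on the left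
  instead of decaying, so the increment keeps the length of the segment. Subtracting
  \<open>z\<close> from \<open>P\<close> isolates this contribution and leaves a derivative of size
  \<open>exp x\<close>.\<close>

lemma hankel_primitive_at_bot_1:
  assumes P: "\<And>z. (P has_field_derivative hankel_fun 1 z) (at z)" and ab: "a \<le> b"
  shows "((\<lambda>x. P (Complex x b) - P (Complex x a)) \<longlongrightarrow> \<i> * of_real (b - a)) at_bot"
proof -
  define Q where "Q = (\<lambda>z. P z - z)"
  have Q: "(Q has_field_derivative exp (exp z) - 1) (at z)" for z
    unfolding Q_def by (auto intro!: derivative_eq_intros P simp: hankel_fun_def)
  have "((\<lambda>x. Q (Complex x b) - Q (Complex x a)) \<longlongrightarrow> 0) at_bot"
  proof (rule Lim_null_comparison)
    show "\<forall>\<^sub>F x in at_bot. norm (Q (Complex x b) - Q (Complex x a)) \<le> exp (exp x) * exp x * (b - a)"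
    proof (intro always_eventually allI vertical_increment_bound [OF Q _ ab])
      fix x y
      show "norm (exp (exp (Complex x y)) - 1) \<le> exp (exp x) * exp x"
      proof -
        have "norm (exp (exp (Complex x y)) - 1) \<le> exp \<bar>Re (exp (Complex x y))\<bar> * exp x"
          using Taylor_exp [of "exp (Complex x y)" 0] by simp
        also have "\<dots> \<le> exp (exp x) * exp x"
          using abs_Re_le_cmod [of "exp (Complex x y)"] by (intro mult_right_mono) auto
        finally show ?thesis .
      qed
    qed
    show "((\<lambda>x. exp (exp x) * exp x * (b - a)) \<longlongrightarrow> 0) at_bot"
      by real_asymp
  qed
  then have "((\<lambda>x. Q (Complex x b) - Q (Complex x a) + \<i> * of_real (b - a)) \<longlongrightarrow> 0 + \<i> * of_real (b - a)) at_bot"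
    by (intro tendsto_intros)
  moreover have "Q (Complex x b) - Q (Complex x a) + \<i> * of_real (b - a) = P (Complex x b) - P (Complex x a)" for x
    by (simp add: Q_def complex_eq_iff)
  ultimately show ?thesis by simp
qed

section \<open>Hankel's formula for the reciprocal Gamma function\<close>

text \<open>The lower incomplete Gamma function with parameter \<open>1 - s\<close>. Composed with
  \<open>exp\<close>, it is an explicit primitive, up to a constant factor, for the jump of the
  integrand between the two edges of the strip.\<close>

lemma incomplete_Gamma:
  fixes s :: real
  assumes s: "s < 0"
  defines "g \<equiv> \<lambda>y. integral {0..y} (\<lambda>v. v powr (- s) * exp (- v))"
  shows "y > 0 \<Longrightarrow> (g has_real_derivative y powr (- s) * exp (- y)) (at y)"
    and "(g \<longlongrightarrow> Gamma (1 - s)) at_top"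
    and "(g \<longlongrightarrow> 0) (at_right 0)"
proof -
  have cont: "continuous_on {0..b} (\<lambda>v. v powr (- s) * exp (- v))" for b
    using s by (intro continuous_intros continuous_on_powr') auto
  show "(g has_real_derivative y powr (- s) * exp (- y)) (at y)" if "y > 0" for y
  proof -
    have "(g has_real_derivative y powr (- s) * exp (- y)) (at y within {0..y + 1})"
      unfolding g_def by (rule integral_has_real_derivative [OF cont]) (use that in auto)
    then show ?thesis using that by (simp add: at_within_Icc_at)
  qed
  have I: "((\<lambda>v. v powr (- s) * exp (- v)) has_integral Gamma (1 - s)) {0..}"
    using Gamma_integral_real [of "1 - s"] s by (simp add: exp_minus field_simps)
  then have A: "(\<lambda>v. v powr (- s) * exp (- v)) absolutely_integrable_on {0..}"
    by (intro nonnegative_absolutely_integrable_1) (auto simp: has_integral_integrable)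
  have "((\<lambda>b. set_lebesgue_integral lebesgue {0..b} (\<lambda>v. v powr (- s) * exp (- v)))
          \<longlongrightarrow> set_lebesgue_integral lebesgue {0..} (\<lambda>v. v powr (- s) * exp (- v))) at_top"
    by (rule tendsto_set_lebesgue_integral_at_top) (use A in auto)
  moreover have "set_lebesgue_integral lebesgue {0..b} (\<lambda>v. v powr (- s) * exp (- v)) = g b" for b
    unfolding g_def
    by (rule set_lebesgue_integral_eq_integral(2), rule set_integrable_subset [OF A]) auto
  moreover have "set_lebesgue_integral lebesgue {0..} (\<lambda>v. v powr (- s) * exp (- v)) = Gamma (1 - s)"
    using set_lebesgue_integral_eq_integral(2) [OF A] integral_unique [OF I] by simp
  ultimately show "(g \<longlongrightarrow> Gamma (1 - s)) at_top" by simp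
  have "continuous_on {0..1} g"
    unfolding g_def by (intro indefinite_integral_continuous_1 integrable_continuous_interval cont)
  then have "(g \<longlongrightarrow> g 0) (at 0 within {0..1})"
    by (auto simp: continuous_on)
  then show "(g \<longlongrightarrow> 0) (at_right 0)"
    by (simp add: g_def at_within_Icc_at_right)
qed

lemma exp_minus_exp_conv_sin: "exp (\<i> * of_real t) - exp (- (\<i> * of_real t)) = 2 * \<i> * of_real (sin t)"
  by (simp add: exp_Euler exp_minus_Euler cis_conv_exp sin_of_real cos_of_real)

text \<open>The reflection formula in a form valid at the nonpositive integers too, where both sides
  vanish.\<close>

lemma sin_rGamma_Gamma: "sin (pi * (1 - s)) * Gamma (1 - s) = pi * rGamma s"
  if "s < 1" for s :: real
proof -
  have "of_real (rGamma s * rGamma (1 - s)) = (of_real (sin (pi * s) / pi) :: complex)"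
    using rGamma_reflection_complex [of "of_real s"]
    by (simp flip: rGamma_complex_of_real sin_of_real)
  then have "rGamma s * rGamma (1 - s) = sin (pi * s) / pi"
    by (simp only: of_real_eq_iff)
  moreover have "rGamma (1 - s) = inverse (Gamma (1 - s))" "Gamma (1 - s) > 0"
    using that by (auto simp: rGamma_inverse_Gamma)
  moreover have "sin (pi * (1 - s)) = sin (pi * s)"
    by (simp add: right_diff_distrib sin_diff)
  ultimately show ?thesis
    by (simp add: field_simps)
qed

text \<open>On both edges \<open>exp z = - exp x\<close>, so the integrands differ only in phase,
  and their difference is \<open>2 * \<i> * sin (pi * (1 - s))\<close> times the derivative of
  \<open>g (exp x)\<close>. Both the increment of \<open>P\<close> and \<open>g (exp x)\<close>
  vanish at minus infinity, hence they are proportional; at plus infinity \<open>g\<close> gives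
  \<open>Gamma (1 - s)\<close>, and reflection finishes.\<close>

lemma hankel_limit_neg:
  assumes P: "\<And>z. (P has_field_derivative hankel_fun s z) (at z)" and s: "s < 0"
  shows "((\<lambda>x. P (Complex x pi) - P (Complex x (- pi))) \<longlongrightarrow> 2 * \<i> * of_real (pi * rGamma s)) at_top"
proof -
  define g where "g = (\<lambda>y. integral {0..y} (\<lambda>v. v powr (- s) * exp (- v)))"
  note g = incomplete_Gamma [OF s, folded g_def]
  define c where "c = (2 * \<i> * of_real (sin (pi * (1 - s))) :: complex)"
  define D where "D = (\<lambda>x. P (Complex x pi) - P (Complex x (- pi)))"
  have "((\<lambda>x. D x - of_real (g (exp x)) * c) has_vector_derivative 0) (at x)" for x
  proof -
    have eq: "hankel_fun s (Complex x pi) - hankel_fun s (Complex x (- pi)) =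
           of_real (exp ((1 - s) * x - exp x)) * c"
    proof -
      have "exp (Complex x pi) = - of_real (exp x)" "exp (Complex x (- pi)) = - of_real (exp x)"
        by (simp_all add: complex_eq_iff Re_exp Im_exp)
      then have "hankel_fun s (Complex x pi) = of_real (exp ((1 - s) * x - exp x)) * exp (\<i> * of_real (pi * (1 - s)))"
        "hankel_fun s (Complex x (- pi)) = of_real (exp ((1 - s) * x - exp x)) * exp (- (\<i> * of_real (pi * (1 - s))))"
        by (simp_all add: hankel_fun_def Complex_eq algebra_simps flip: exp_add exp_of_real)
      then show ?thesis unfolding c_def
        by (simp only: exp_minus_exp_conv_sin flip: right_diff_distrib)
    qed
    have "((\<lambda>x. g (exp x)) has_real_derivative (exp x powr (- s) * exp (- exp x)) * exp x) (at x)"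
      by (rule DERIV_chain2 [OF g(1)]) (auto intro!: derivative_eq_intros)
    also have "(exp x powr (- s) * exp (- exp x)) * exp x = exp ((1 - s) * x - exp x)"
      by (simp add: powr_def algebra_simps flip: exp_add)
    finally have "((\<lambda>x. g (exp x)) has_real_derivative exp ((1 - s) * x - exp x)) (at x)" .
    then show ?thesis
      unfolding D_def
      by (auto intro!: derivative_eq_intros vector_derivative_horizontal [OF P] simp: eq)
  qed
  then obtain k where k: "\<And>x. D x - of_real (g (exp x)) * c = k"
    using has_vector_derivative_zero_constant [of UNIV "\<lambda>x. D x - of_real (g (exp x)) * c"] by auto
  have "((\<lambda>x. D x - of_real (g (exp x)) * c) \<longlongrightarrow> 0 - of_real 0 * c) at_bot"
  proof (intro tendsto_intros)
    show "(D \<longlongrightarrow> 0) at_bot"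
      unfolding D_def by (rule hankel_primitive_at_bot [OF P]) (use s in auto)
    show "((\<lambda>x. g (exp x)) \<longlongrightarrow> 0) at_bot"
      by (rule filterlim_compose [OF g(3)]) (use exp_at_bot in \<open>auto simp: filterlim_at\<close>)
  qed
  then have "k = 0 - of_real 0 * c"
    unfolding k by (rule tendsto_unique [OF trivial_limit_at_bot_linorder tendsto_const])
  then have "k = 0" by simp
  then have D: "D = (\<lambda>x. of_real (g (exp x)) * c)"
    using k by auto
  have "((\<lambda>x. of_real (g (exp x)) * c) \<longlongrightarrow> of_real (Gamma (1 - s)) * c) at_top"
    by (intro tendsto_intros filterlim_compose [OF g(2) exp_at_top])
  moreover have "of_real (Gamma (1 - s)) * c = 2 * \<i> * of_real (pi * rGamma s)"
    using arg_cong [OF sin_rGamma_Gamma [of s], of complex_of_real] s by (simp add: c_def mult_ac)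
  ultimately show ?thesis
    using D unfolding D_def by simp
qed

text \<open>The integrand for \<open>s = 1\<close> has period \<open>2 * pi * \<i>\<close>, so the
  increment across the strip does not depend on \<open>x\<close> and equals its limit on the
  left.\<close>

lemma hankel_limit_1:
  assumes P: "\<And>z. (P has_field_derivative hankel_fun 1 z) (at z)"
  shows "((\<lambda>x. P (Complex x pi) - P (Complex x (- pi))) \<longlongrightarrow> 2 * \<i> * of_real (pi * rGamma 1)) at_top"
proof -
  define D where "D = (\<lambda>x. P (Complex x pi) - P (Complex x (- pi)))"
  have "(D has_vector_derivative 0) (at x)" for x
  proof -
    have "exp (Complex x pi) = exp (Complex x (- pi))"
      by (simp add: complex_eq_iff Re_exp Im_exp)
    then have "hankel_fun 1 (Complex x pi) - hankel_fun 1 (Complex x (- pi)) = 0"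
      by (simp add: hankel_fun_def)
    then show ?thesis
      unfolding D_def
      by (auto intro!: derivative_eq_intros vector_derivative_horizontal [OF P])
  qed
  then obtain k where k: "\<And>x. D x = k"
    using has_vector_derivative_zero_constant [of UNIV D] by auto
  have "(D \<longlongrightarrow> \<i> * of_real (pi - (- pi))) at_bot"
    unfolding D_def by (rule hankel_primitive_at_bot_1 [OF P]) auto
  then have "k = \<i> * of_real (pi - (- pi))" unfolding k
    by (rule tendsto_unique [OF trivial_limit_at_bot_linorder tendsto_const])
  then have "k = 2 * \<i> * of_real (pi * rGamma 1)" by simp
  then show ?thesis using k by (simp add: D_def)
qed

lemma hankel_limit:
  assumes P: "\<And>z. (P has_field_derivative hankel_fun s z) (at z)"
  shows "((\<lambda>x. P (Complex x pi) - P (Complex x (- pi))) \<longlongrightarrow> 2 * \<i> * of_real (pi * rGamma s)) at_top"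
proof -
  \<comment> \<open>If \<open>P\<close> is a primitive for \<open>s\<close>, then integration by parts gives the primitive
    \<open>E + (s - 1) * P\<close> for \<open>s - 1\<close>; the pole \<open>s = 1\<close> of this recursion needs a separate argument.\<close>
  have "((\<lambda>x. P (Complex x pi) - P (Complex x (- pi))) \<longlongrightarrow> 2 * \<i> * of_real (pi * rGamma s)) at_top"
    if "s < real n" "\<And>z. (P has_field_derivative hankel_fun s z) (at z)" for n s and P :: "complex \<Rightarrow> complex"
    using that
  proof (induction n arbitrary: s P)
    case 0
    then show ?case by (intro hankel_limit_neg) auto
  next
    case (Suc n)
    show ?case
    proof (cases "s = 1")
      case True
      then show ?thesis using Suc.prems hankel_limit_1 by blast
    next
      case False
      define r where "r = s - 1"
      define E :: "complex \<Rightarrow> complex" where "E = (\<lambda>z. exp (exp z - of_real r * z))"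
      have "((\<lambda>z. E z + of_real r * P z) has_field_derivative hankel_fun r z) (at z)" for z
      proof -
        have "(E has_field_derivative E z * (exp z - of_real r)) (at z)"
          unfolding E_def by (auto intro!: derivative_eq_intros)
        moreover have "hankel_fun s z = E z" "hankel_fun r z = E z * exp z"
          by (simp_all add: hankel_fun_def E_def r_def algebra_simps flip: exp_add)
        ultimately show ?thesis
          using DERIV_cmult [OF Suc.prems(2), of "of_real r" z]
          by (auto dest: DERIV_add simp: algebra_simps)
      qed
      then have lim: "((\<lambda>x. (E (Complex x pi) + of_real r * P (Complex x pi)) - (E (Complex x (- pi)) + of_real r * P (Complex x (- pi))))
          \<longlongrightarrow> 2 * \<i> * of_real (pi * rGamma r)) at_top"
        using Suc.prems(1) by (intro Suc.IH) (auto simp: r_def)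
      have E: "((\<lambda>x. E (Complex x y)) \<longlongrightarrow> 0) at_top" if "cos y = - 1" for y
      proof (rule Lim_null_comparison)
        show "\<forall>\<^sub>F x in at_top. norm (E (Complex x y)) \<le> exp (- exp x - r * x)"
          using that by (simp add: E_def Re_exp)
        show "((\<lambda>x. exp (- exp x - r * x)) \<longlongrightarrow> 0) at_top" by real_asymp
      qed
      have r: "r \<noteq> 0" using False by (simp add: r_def)
      \<comment> \<open>The boundary terms \<open>E\<close> die out at heights \<open>pi\<close> and
        \<open>- pi\<close>. Removing them and dividing by \<open>r\<close> isolates the increment
        of \<open>P\<close>; the recurrence \<open>rGamma r = r * rGamma s\<close> matches the
        limits.\<close>
      have "((\<lambda>x. ((E (Complex x pi) + of_real r * P (Complex x pi)) - (E (Complex x (- pi)) + of_real r * P (Complex x (- pi)))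
            - (E (Complex x pi) - E (Complex x (- pi)))) / of_real r)
            \<longlongrightarrow> (2 * \<i> * of_real (pi * rGamma r) - (0 - 0)) / of_real r) at_top"
        using r by (intro tendsto_intros lim E) auto
      moreover have "(2 * \<i> * of_real (pi * rGamma r) - (0 - 0)) / of_real r = 2 * \<i> * of_real (pi * rGamma s)"
      proof -
        have "rGamma r = r * rGamma s"
          using rGamma_plus1 [of r] by (simp add: r_def)
        then show ?thesis using r by simp
      qed
      moreover have "((E (Complex x pi) + of_real r * P (Complex x pi)) - (E (Complex x (- pi)) + of_real r * P (Complex x (- pi)))
            - (E (Complex x pi) - E (Complex x (- pi)))) / of_real r = P (Complex x pi) - P (Complex x (- pi))" for x
        using r by (simp add: field_simps)
      ultimately show ?thesis by simp
    qed
  qed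
  moreover obtain n where "s < real n" using reals_Archimedean2 by blast
  ultimately show ?thesis using P by blast
qed

text \<open>Between heights \<open>\<theta>\<close> and \<open>pi\<close> the cosine is at most
  \<open>cos \<theta> < 0\<close>, and likewise below the real axis by symmetry, so narrowing the
  strip changes the increment by a quantity that tends to 0.\<close>

lemma hankel_limit_angle:
  assumes P: "\<And>z. (P has_field_derivative hankel_fun s z) (at z)" and \<theta>: "pi / 2 < \<theta>" "\<theta> \<le> pi"
  shows "((\<lambda>x. P (Complex x \<theta>) - P (Complex x (- \<theta>))) \<longlongrightarrow> 2 * \<i> * of_real (pi * rGamma s)) at_top"
proof -
  have c: "- cos \<theta> > 0"
    using cos_gt_zero_pi [of "pi - \<theta>"] \<theta> by (simp add: cos_diff)
  have cos: "cos y \<le> - (- cos \<theta>)" if "y \<in> {\<theta>..pi}" for y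
    using that \<theta> cos_monotone_0_pi_le [of \<theta> y] pi_gt_zero by auto
  have "((\<lambda>x. (P (Complex x pi) - P (Complex x (- pi))) - (P (Complex x pi) - P (Complex x \<theta>))
          - (P (Complex x (- \<theta>)) - P (Complex x (- pi)))) \<longlongrightarrow> 2 * \<i> * of_real (pi * rGamma s) - 0 - 0) at_top"
  proof (intro tendsto_diff)
    show "((\<lambda>x. P (Complex x (- \<theta>)) - P (Complex x (- pi))) \<longlongrightarrow> 0) at_top"
    proof (rule hankel_primitive_at_top [OF P c])
      fix y assume "y \<in> {- pi..- \<theta>}"
      then show "cos y \<le> - (- cos \<theta>)" using cos [of "- y"] by auto
    qed (use \<theta> in auto)
  qed (use hankel_limit [OF P] hankel_primitive_at_top [OF P c cos] \<theta> in auto)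
  then show ?thesis by (simp add: algebra_simps)
qed

section \<open>Integration along the contour and dominated convergence\<close>

lemma set_integrable_exp_minus_exp:
  fixes c \<sigma> k y :: real
  assumes c: "c > 0" and \<sigma>: "\<sigma> < 1"
  shows "set_integrable lborel {0..} (\<lambda>x. exp (- c * exp x + k * x + y * exp (\<sigma> * x)))"
proof -
  define f where "f = (\<lambda>x. exp (- c * exp x + k * x + y * exp (\<sigma> * x)))"
  have cont: "continuous_on A f" for A unfolding f_def by (intro continuous_intros)
  \<comment> \<open>The goal is \<open>f x \<le> exp (- x)\<close> for large \<open>x\<close>, that
    is \<open>k * x + x + y * exp (\<sigma> * x) \<le> c * exp x\<close>. Divided by
    \<open>exp x\<close>, the left side tends to 0 because \<open>\<sigma> < 1\<close>.\<close>
  have lim: "((\<lambda>x. k * x * exp (- x) + x * exp (- x) + y * exp ((\<sigma> - 1) * x)) \<longlongrightarrow> 0 + 0 + y * 0) at_top"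
  proof (intro tendsto_intros)
    show "((\<lambda>x. exp ((\<sigma> - 1) * x)) \<longlongrightarrow> 0) at_top"
    proof -
      define d where "d = 1 - \<sigma>"
      have "d > 0" using \<sigma> by (simp add: d_def)
      then have "((\<lambda>x. exp (- d * x)) \<longlongrightarrow> 0) at_top" by real_asymp
      then show ?thesis by (simp add: d_def)
    qed
    show "((\<lambda>x. x * exp (- x)) \<longlongrightarrow> (0::real)) at_top" by real_asymp
    show "((\<lambda>x. k * x * exp (- x)) \<longlongrightarrow> (0::real)) at_top" by real_asymp
  qed
  then have "\<forall>\<^sub>F x in at_top. k * x * exp (- x) + x * exp (- x) + y * exp ((\<sigma> - 1) * x) < c"
    by (rule order_tendstoD) (use c in auto)
  then obtain a0 where a0: "\<And>x. x \<ge> a0 \<Longrightarrow> k * x * exp (- x) + x * exp (- x) + y * exp ((\<sigma> - 1) * x) < c"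
    by (auto simp: eventually_at_top_linorder)
  define a where "a = max a0 0"
  have bd: "f x \<le> exp (- x)" if "x \<ge> a" for x
  proof -
    have "exp x * (k * x * exp (- x) + x * exp (- x) + y * exp ((\<sigma> - 1) * x)) \<le> exp x * c"
      using a0 [of x] that by (intro mult_left_mono) (auto simp: a_def)
    also have "exp x * (k * x * exp (- x) + x * exp (- x) + y * exp ((\<sigma> - 1) * x)) = k * x + x + y * exp (\<sigma> * x)"
      by (simp add: algebra_simps exp_minus exp_diff)
    finally show ?thesis by (simp add: f_def algebra_simps)
  qed
  have "(\<lambda>x. exp (- 1 * x)) absolutely_integrable_on {a..}"
    by (intro nonnegative_absolutely_integrable_1 integrable_on_exp_minus_to_infinity) auto
  then have I: "set_integrable lborel {a..} (\<lambda>x. exp (- x))"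
    unfolding set_integrable_def by (subst (asm) integrable_completion) auto
  have "set_integrable lborel {a..} f"
    by (rule set_integrable_bound [OF I])
       (use bd in \<open>auto simp: set_borel_measurable_def f_def\<close>)
  moreover have "set_integrable lborel {0..a} f"
    by (rule borel_integrable_atLeastAtMost' [OF cont])
  ultimately have "set_integrable lborel ({0..a} \<union> {a..}) f"
    by (intro set_integrable_Un) auto
  moreover have "{0..a} \<union> {a..} = {0..}" by (auto simp: a_def)
  ultimately show ?thesis by (simp add: f_def)
qed

text \<open>Two majorants serve different purposes: \<open>w\<close> dominates the whole sequence
  and may be large, while \<open>v\<close> bounds only the limit. In the application
  \<open>w\<close> depends on the variable of the series and \<open>v\<close> does not, which makes
  the final bound uniform.\<close>

lemma set_dominated_convergence:
  fixes f :: "nat \<Rightarrow> real \<Rightarrow> complex"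
  assumes A: "A \<in> sets borel"
    and f: "\<And>n. continuous_on A (f n)"
    and lim: "\<And>x. x \<in> A \<Longrightarrow> (\<lambda>n. f n x) \<longlonglongrightarrow> g x"
    and w: "set_integrable lborel A w" "\<And>n x. x \<in> A \<Longrightarrow> norm (f n x) \<le> w x"
    and v: "set_integrable lborel A v" "\<And>x. x \<in> A \<Longrightarrow> norm (g x) \<le> v x"
  shows "(\<lambda>n. LINT x:A|lborel. f n x) \<longlonglongrightarrow> (LINT x:A|lborel. g x)"
    and "norm (LINT x:A|lborel. g x) \<le> (LINT x:A|lborel. v x)"
proof -
  have m: "(\<lambda>x. indicator A x *\<^sub>R f n x) \<in> borel_measurable lborel" for n
    using borel_measurable_continuous_on_indicator [OF A f] by simp
  have l: "(\<lambda>n. indicator A x *\<^sub>R f n x) \<longlonglongrightarrow> indicator A x *\<^sub>R g x" for x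
    using lim by (auto simp: indicator_def)
  have mg: "(\<lambda>x. indicator A x *\<^sub>R g x) \<in> borel_measurable lborel"
    by (rule borel_measurable_LIMSEQ_metric [OF m l])
  note * = mg m w(1)[unfolded set_integrable_def] AE_I2[OF l] AE_I2[of lborel "\<lambda>x. norm (indicator A x *\<^sub>R f n x) \<le> indicator A x *\<^sub>R w x" for n]
  show "(\<lambda>n. LINT x:A|lborel. f n x) \<longlonglongrightarrow> (LINT x:A|lborel. g x)"
    unfolding set_lebesgue_integral_def
    by (rule integral_dominated_convergence [OF *]) (use w(2) in \<open>auto simp: indicator_def\<close>)
  have "integrable lborel (\<lambda>x. indicator A x *\<^sub>R g x)"
    by (rule integrable_dominated_convergence [OF *]) (use w(2) in \<open>auto simp: indicator_def\<close>)
  then show "norm (LINT x:A|lborel. g x) \<le> (LINT x:A|lborel. v x)"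
    unfolding set_lebesgue_integral_def
    by (rule Bochner_Integration.integral_norm_bound_integral [OF _ v(1)[unfolded set_integrable_def]])
       (use v(2) in \<open>auto simp: indicator_def\<close>)
qed

text \<open>
  The contour comes from \<open>\<infinity> - \<i> \<theta>\<close> along a horizontal ray to \<open>- \<i> \<theta>\<close>, goes up the imaginary
  axis to \<open>\<i> \<theta>\<close> and leaves along a horizontal ray to \<open>\<infinity> + \<i> \<theta>\<close>.
\<close>

definition hankel_integrable :: "real \<Rightarrow> (complex \<Rightarrow> 'a::{banach, second_countable_topology}) \<Rightarrow> bool"
  where "hankel_integrable \<theta> f \<longleftrightarrow>
    set_integrable lborel {0..} (\<lambda>x. f (Complex x \<theta>)) \<and>
    set_integrable lborel {0..} (\<lambda>x. f (Complex x (- \<theta>))) \<and>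
    set_integrable lborel {-\<theta>..\<theta>} (\<lambda>y. f (Complex 0 y))"

definition hankel_integral :: "real \<Rightarrow> (complex \<Rightarrow> complex) \<Rightarrow> complex" where
  "hankel_integral \<theta> f =
     (LINT x:{0..}|lborel. f (Complex x \<theta>)) - (LINT x:{0..}|lborel. f (Complex x (- \<theta>)))
     + \<i> * (LINT y:{-\<theta>..\<theta>}|lborel. f (Complex 0 y))"

text \<open>Integration against arc length on the contour: the orientation signs of
  \<open>hankel_integral\<close> are dropped so that a majorant of the integrand bounds the norm of
  the integral.\<close>

definition hankel_mass :: "real \<Rightarrow> (complex \<Rightarrow> real) \<Rightarrow> real" where
  "hankel_mass \<theta> f =
     (LINT x:{0..}|lborel. f (Complex x \<theta>)) + (LINT x:{0..}|lborel. f (Complex x (- \<theta>)))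
     + (LINT y:{-\<theta>..\<theta>}|lborel. f (Complex 0 y))"

lemma continuous_on_Complex [continuous_intros]:
  assumes "continuous_on A f" "continuous_on A g"
  shows "continuous_on A (\<lambda>x. Complex (f x) (g x))"
  unfolding Complex_eq by (intro continuous_intros assms)

text \<open>The partial sums of the series for \<open>E\<close> at
  \<open>- y * exp (\<sigma> * z)\<close> are bounded by a multiple of
  \<open>exp (y * exp (\<sigma> * Re z))\<close>. On both rays the decay rate is
  \<open>- cos \<theta> > 0\<close>, which wins because \<open>\<sigma> < 1\<close>.\<close>

lemma hankel_integrable_majorant:
  assumes \<theta>: "pi / 2 < \<theta>" "\<theta> \<le> pi" and \<sigma>: "\<sigma> < 1"
  shows "hankel_integrable \<theta> (\<lambda>z. norm (hankel_fun s z) * exp (y * exp (\<sigma> * Re z)))"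
proof -
  have c: "- cos \<theta> > 0"
    using cos_gt_zero_pi [of "pi - \<theta>"] \<theta> by (simp add: cos_diff)
  have "set_integrable lborel {0..} (\<lambda>x. norm (hankel_fun s (Complex x t)) * exp (y * exp (\<sigma> * x)))"
    if "cos t = cos \<theta>" for t
  proof -
    have "norm (hankel_fun s (Complex x t)) * exp (y * exp (\<sigma> * x)) =
        exp (- (- cos \<theta>) * exp x + (1 - s) * x + y * exp (\<sigma> * x))" for x
      by (simp add: norm_hankel_fun that mult.commute flip: exp_add)
    then show ?thesis
      using set_integrable_exp_minus_exp [OF c \<sigma>] by simp
  qed
  moreover have "set_integrable lborel {-\<theta>..\<theta>} (\<lambda>t. norm (hankel_fun s (Complex 0 t)) * exp (y * exp (\<sigma> * 0)))"
    by (intro borel_integrable_atLeastAtMost' continuous_intros)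
  ultimately show ?thesis unfolding hankel_integrable_def by simp
qed

lemma hankel_integrable_norm_hankel_fun:
  assumes \<theta>: "pi / 2 < \<theta>" "\<theta> \<le> pi"
  shows "hankel_integrable \<theta> (\<lambda>z. norm (hankel_fun s z))"
  using hankel_integrable_majorant [OF \<theta>, of 0 s 0] by simp

lemma hankel_integrable_hankel_fun:
  assumes \<theta>: "pi / 2 < \<theta>" "\<theta> \<le> pi"
  shows "hankel_integrable \<theta> (hankel_fun s)"
proof -
  have *: "set_integrable lborel A (\<lambda>x. hankel_fun s (f x))"
    if "set_integrable lborel A (\<lambda>x. norm (hankel_fun s (f x)))" "A \<in> sets borel" "continuous_on A f" for A f
  proof (rule set_integrable_bound [OF that(1)])
    show "set_borel_measurable lborel A (\<lambda>x. hankel_fun s (f x))"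
      using borel_measurable_continuous_on_indicator [OF that(2) continuous_on_hankel_fun [OF that(3)]]
      by (simp add: set_borel_measurable_def)
  qed auto
  then show ?thesis
    using hankel_integrable_norm_hankel_fun [OF \<theta>, of s]
    unfolding hankel_integrable_def by (intro conjI *) (auto intro!: continuous_intros)
qed

text \<open>Each piece of the contour is an increment of a primitive \<open>P\<close>. The
  increments telescope, leaving the difference of \<open>P\<close> at the two far ends, whose limit
  is known.\<close>

lemma hankel_integral_hankel_fun:
  assumes \<theta>: "pi / 2 < \<theta>" "\<theta> \<le> pi"
  shows "hankel_integral \<theta> (hankel_fun s) = 2 * \<i> * of_real (pi * rGamma s)"
proof -
  obtain P where P: "\<And>z. (P has_field_derivative hankel_fun s z) (at z)"
    using hankel_fun_has_primitive by blast
  have int: "set_integrable lborel {0..} (\<lambda>x. hankel_fun s (Complex x t))" if "t \<in> {\<theta>, -\<theta>}" for t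
    using hankel_integrable_hankel_fun [OF \<theta>, of s] that by (auto simp: hankel_integrable_def)
  have horizontal: "((\<lambda>b. P (Complex b t) - P (Complex 0 t)) \<longlongrightarrow> (LINT x:{0..}|lborel. hankel_fun s (Complex x t))) at_top"
    if "t \<in> {\<theta>, -\<theta>}" for t
  proof (rule Lim_transform_eventually)
    show "((\<lambda>b. LINT x:{0..b}|lborel. hankel_fun s (Complex x t)) \<longlongrightarrow> (LINT x:{0..}|lborel. hankel_fun s (Complex x t))) at_top"
      by (rule tendsto_set_lebesgue_integral_at_top) (use int [OF that] in auto)
    show "\<forall>\<^sub>F b in at_top. (LINT x:{0..b}|lborel. hankel_fun s (Complex x t)) = P (Complex b t) - P (Complex 0 t)"
      using eventually_ge_at_top [of 0]
    proof eventually_elim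
      case (elim b)
      show ?case
        unfolding set_lebesgue_integral_def
        by (rule integral_FTC_atLeastAtMost [OF elim vector_derivative_horizontal [OF P]])
           (intro continuous_intros)
    qed
  qed
  have vertical: "\<i> * (LINT y:{-\<theta>..\<theta>}|lborel. hankel_fun s (Complex 0 y)) = P (Complex 0 \<theta>) - P (Complex 0 (- \<theta>))"
  proof -
    have "\<i> * (LINT y:{-\<theta>..\<theta>}|lborel. hankel_fun s (Complex 0 y)) = (LINT y:{-\<theta>..\<theta>}|lborel. \<i> * hankel_fun s (Complex 0 y))"
      by simp
    also have "\<dots> = P (Complex 0 \<theta>) - P (Complex 0 (- \<theta>))"
      unfolding set_lebesgue_integral_def
      by (rule integral_FTC_atLeastAtMost [OF _ vector_derivative_vertical [OF P]])
         (use \<theta> pi_gt_zero in \<open>auto intro!: continuous_intros\<close>)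
    finally show ?thesis .
  qed
  have "((\<lambda>b. (P (Complex b \<theta>) - P (Complex 0 \<theta>)) - (P (Complex b (- \<theta>)) - P (Complex 0 (- \<theta>)))
           + (P (Complex 0 \<theta>) - P (Complex 0 (- \<theta>)))) \<longlongrightarrow> hankel_integral \<theta> (hankel_fun s)) at_top"
    unfolding hankel_integral_def vertical by (intro tendsto_intros horizontal) auto
  then have "((\<lambda>b. P (Complex b \<theta>) - P (Complex b (- \<theta>))) \<longlongrightarrow> hankel_integral \<theta> (hankel_fun s)) at_top"
    by (simp add: algebra_simps)
  then show ?thesis
    using hankel_limit_angle [OF P \<theta>] tendsto_unique trivial_limit_at_top_linorder by blast
qed

lemma hankel_integral_sum_cmult:
  assumes "\<And>n. n \<in> N \<Longrightarrow> hankel_integrable \<theta> (f n)"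
  shows "hankel_integral \<theta> (\<lambda>z. \<Sum>n\<in>N. c n * f n z) = (\<Sum>n\<in>N. c n * hankel_integral \<theta> (f n))"
proof -
  have *: "(LINT x:A|lborel. \<Sum>n\<in>N. c n * f n (g x)) = (\<Sum>n\<in>N. c n * (LINT x:A|lborel. f n (g x)))"
    if "\<And>n. n \<in> N \<Longrightarrow> set_integrable lborel A (\<lambda>x. f n (g x))" for A and g :: "real \<Rightarrow> complex"
    unfolding set_lebesgue_integral_def scaleR_sum_right
    by (subst Bochner_Integration.integral_sum)
       (use that in \<open>auto simp: set_integrable_def simp flip: mult_scaleR_right\<close>)
  show ?thesis
    unfolding hankel_integral_def
    by (subst *, use assms in \<open>force simp: hankel_integrable_def\<close>)+
       (simp add: sum_distrib_left sum_subtractf sum.distrib algebra_simps)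
qed

text \<open>The bound \<open>v\<close> on the limit is required only for
  \<open>\<bar>Im z\<bar> \<le> \<theta>\<close>, since the contour stays in that strip and the
  half-plane estimate is available only there.\<close>

lemma hankel_dominated_convergence:
  fixes f :: "nat \<Rightarrow> complex \<Rightarrow> complex"
  assumes f: "\<And>n. continuous_on UNIV (f n)"
    and lim: "\<And>z. (\<lambda>n. f n z) \<longlonglongrightarrow> g z"
    and w: "hankel_integrable \<theta> w" "\<And>n z. norm (f n z) \<le> w z"
    and v: "hankel_integrable \<theta> v" "\<And>z. \<bar>Im z\<bar> \<le> \<theta> \<Longrightarrow> norm (g z) \<le> v z"
    and \<theta>: "\<theta> \<ge> 0"
  shows "(\<lambda>n. hankel_integral \<theta> (f n)) \<longlonglongrightarrow> hankel_integral \<theta> g"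
    and "norm (hankel_integral \<theta> g) \<le> hankel_mass \<theta> v"
proof -
  have *: "(\<lambda>n. LINT x:A|lborel. f n (h x)) \<longlonglongrightarrow> (LINT x:A|lborel. g (h x))"
    "norm (LINT x:A|lborel. g (h x)) \<le> (LINT x:A|lborel. v (h x))"
    if "A \<in> sets borel" "continuous_on A h" "set_integrable lborel A (\<lambda>x. w (h x))"
      "set_integrable lborel A (\<lambda>x. v (h x))" "\<And>x. x \<in> A \<Longrightarrow> \<bar>Im (h x)\<bar> \<le> \<theta>" for A and h :: "real \<Rightarrow> complex"
  proof -
    note dc = set_dominated_convergence [where f = "\<lambda>n x. f n (h x)" and g = "\<lambda>x. g (h x)"
          and w = "\<lambda>x. w (h x)" and v = "\<lambda>x. v (h x)", OF that(1) _ lim that(3) w(2) that(4)]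
    have c: "continuous_on A (\<lambda>x. f n (h x))" for n
      by (rule continuous_on_compose2 [OF f that(2)]) auto
    show "(\<lambda>n. LINT x:A|lborel. f n (h x)) \<longlonglongrightarrow> (LINT x:A|lborel. g (h x))"
      by (rule dc(1)) (use c v(2) that(5) in auto)
    show "norm (LINT x:A|lborel. g (h x)) \<le> (LINT x:A|lborel. v (h x))"
      by (rule dc(2)) (use c v(2) that(5) in auto)
  qed
  note pieces = * [of "{0..}" "\<lambda>x. Complex x \<theta>"] * [of "{0..}" "\<lambda>x. Complex x (- \<theta>)"] * [of "{-\<theta>..\<theta>}" "Complex 0"]
  note int = w(1)[unfolded hankel_integrable_def] v(1)[unfolded hankel_integrable_def]
  show "(\<lambda>n. hankel_integral \<theta> (f n)) \<longlonglongrightarrow> hankel_integral \<theta> g"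
    unfolding hankel_integral_def
    by (intro tendsto_intros pieces) (use int \<theta> in \<open>auto intro!: continuous_intros\<close>)
  have "norm (hankel_integral \<theta> g) \<le> norm (LINT x:{0..}|lborel. g (Complex x \<theta>)) + norm (LINT x:{0..}|lborel. g (Complex x (- \<theta>)))
     + norm (LINT y:{-\<theta>..\<theta>}|lborel. g (Complex 0 y))"
    unfolding hankel_integral_def
    by (rule order_trans [OF norm_triangle_ineq add_mono [OF norm_triangle_ineq4]]) (simp add: norm_mult)
  also have "\<dots> \<le> hankel_mass \<theta> v"
    unfolding hankel_mass_def
    by (intro add_mono pieces) (use int \<theta> in \<open>auto intro!: continuous_intros\<close>)
  finally show "norm (hankel_integral \<theta> g) \<le> hankel_mass \<theta> v" .
qed

section \<open>The function \<open>E\<close>: growth of partial sums and boundedness on a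
  half-plane\<close>

text \<open>The two-parameter Mittag-Leffler function with first parameter 1 and second parameter
  \<open>b\<close>.\<close>

definition mittag_leffler :: "real \<Rightarrow> complex \<Rightarrow> complex" where
  "mittag_leffler b z = (\<Sum>n. of_real (rGamma (real n + b)) * z ^ n)"

lemma rGamma_nat_add_bounds:
  assumes "b \<ge> (1::real)"
  shows "0 \<le> rGamma (real n + b)" "rGamma (real n + b) \<le> rGamma b / fact n"
proof -
  show nonneg: "0 \<le> rGamma (real n + b)" for n
    using Gamma_real_pos [of "real n + b"] assms by (simp add: rGamma_inverse_Gamma)
  show "rGamma (real n + b) \<le> rGamma b / fact n"
  proof (induction n)
    case (Suc n)
    have "(real n + 1) * rGamma (real (Suc n) + b) \<le> (real n + b) * rGamma (real (Suc n) + b)"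
      using assms nonneg [of "Suc n"] by (intro mult_right_mono) auto
    also have "\<dots> = rGamma (real n + b)"
      using rGamma_plus1 [of "real n + b"] by (simp add: add_ac)
    also have "\<dots> \<le> rGamma b / fact n" by (rule Suc.IH)
    finally have "(real n + 1) * rGamma (real (Suc n) + b) \<le> rGamma b / fact n" .
    then have "rGamma (real (Suc n) + b) \<le> (rGamma b / fact n) / (real n + 1)"
      by (subst pos_le_divide_eq) (simp_all add: mult.commute)
    also have "\<dots> = rGamma b / fact (Suc n)" by (simp add: algebra_simps)
    finally show ?case .
  qed auto
qed

lemma sum_power_fact_le_exp:
  assumes "x \<ge> (0::real)"
  shows "(\<Sum>n<N. x ^ n / fact n) \<le> exp x"
proof -
  have "(\<Sum>n<N. inverse (fact n) * x ^ n) \<le> (\<Sum>n. inverse (fact n) * x ^ n)"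
    by (rule sum_le_suminf) (use assms summable_exp [of x] in auto)
  then show ?thesis
    by (simp add: exp_def divide_inverse mult.commute)
qed

lemma mittag_leffler_partial_sum_bound:
  assumes "b \<ge> 1"
  shows "norm (\<Sum>n<N. of_real (rGamma (real n + b)) * z ^ n :: complex) \<le> rGamma b * exp (norm z)"
proof -
  have "norm (\<Sum>n<N. of_real (rGamma (real n + b)) * z ^ n) \<le> (\<Sum>n<N. rGamma b * (norm z ^ n / fact n))"
  proof (intro sum_norm_le)
    fix n
    show "norm (of_real (rGamma (real n + b)) * z ^ n) \<le> rGamma b * (norm z ^ n / fact n)"
      using mult_right_mono [OF rGamma_nat_add_bounds(2) [OF assms, of n], of "norm z ^ n"]
        rGamma_nat_add_bounds(1) [OF assms, of n]
      by (simp add: norm_mult norm_power)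
  qed
  also have "\<dots> \<le> rGamma b * exp (norm z)"
    unfolding sum_distrib_left [symmetric]
    using rGamma_nat_add_bounds(1) [OF assms, of 0] by (intro mult_left_mono sum_power_fact_le_exp) auto
  finally show ?thesis .
qed

lemma mittag_leffler_sums:
  assumes "b \<ge> 1"
  shows "(\<lambda>n. of_real (rGamma (real n + b)) * z ^ n) sums mittag_leffler b z"
proof -
  have "summable (\<lambda>n. of_real (rGamma (real n + b)) * z ^ n)"
  proof (rule summable_comparison_test')
    show "summable (\<lambda>n. rGamma b * (inverse (fact n) * norm z ^ n))"
      by (intro summable_mult summable_exp)
    fix n :: nat
    show "norm (of_real (rGamma (real n + b)) * z ^ n) \<le> rGamma b * (inverse (fact n) * norm z ^ n)"
      using mult_right_mono [OF rGamma_nat_add_bounds(2) [OF assms, of n], of "norm z ^ n"]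
        rGamma_nat_add_bounds(1) [OF assms, of n]
      by (simp add: norm_mult norm_power divide_inverse mult_ac)
  qed
  then show ?thesis by (simp add: mittag_leffler_def summable_sums)
qed

lemma mittag_leffler_bound:
  assumes b: "b > 2" and z: "Re z \<le> 0"
  shows "norm (mittag_leffler b z) \<le> rGamma (b - 1) * (LINT t:{0..1}|lborel. (1 - t) powr (b - 2))"
proof -
  \<comment> \<open>Termwise Beta integrals: \<open>E w\<close> is a multiple of \<open>\<integral>\<^sub>0\<^sup>1 exp (t w) * (1 - t) powr (b - 2) dt\<close>.\<close>
  define f where "f = (\<lambda>N t. \<Sum>n<N. (z ^ n / fact n) * of_real (t ^ n * (1 - t) powr (b - 2)))"
  define g where "g = (\<lambda>t. exp (of_real t * z) * of_real ((1 - t) powr (b - 2)))"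
  \<comment> \<open>Since \<open>b > 2\<close>, the exponent is positive, so the weight is
    continuous up to \<open>t = 1\<close>.\<close>
  have cont1: "continuous_on {0..1} (\<lambda>t. (1 - t) powr (b - 2))"
    using b by (intro continuous_intros continuous_on_powr') auto
  have cont: "continuous_on {0..1} (\<lambda>t. (z ^ n / fact n) * of_real (t ^ n * (1 - t) powr (b - 2)))" for n
    by (intro continuous_intros cont1)
  have f_eq: "f N t = (\<Sum>n<N. (of_real t * z) ^ n / fact n) * of_real ((1 - t) powr (b - 2))" for N t
    by (simp add: f_def sum_distrib_left power_mult_distrib mult_ac)
  have lim: "(\<lambda>N. f N t) \<longlonglongrightarrow> g t" for t
  proof -
    have "(\<lambda>n. (of_real t * z) ^ n / fact n) sums exp (of_real t * z)"
      using exp_converges [of "of_real t * z"] by (simp add: scaleR_conv_of_real divide_inverse mult.commute)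
    then show ?thesis unfolding f_eq g_def sums_def by (intro tendsto_intros)
  qed
  have bd: "norm (f N t) \<le> exp (norm z) * (1 - t) powr (b - 2)" if "t \<in> {0..1}" for N t
  proof -
    have "norm (\<Sum>n<N. (of_real t * z) ^ n / fact n) \<le> (\<Sum>n<N. (t * norm z) ^ n / fact n)"
      using that by (intro sum_norm_le) (simp add: norm_divide norm_power norm_mult)
    also have "\<dots> \<le> exp (t * norm z)"
      using that by (intro sum_power_fact_le_exp) auto
    also have "\<dots> \<le> exp (norm z)"
      using that mult_right_mono [of t 1 "norm z"] by auto
    finally show ?thesis unfolding f_eq by (simp add: norm_mult mult_right_mono)
  qed
  have Beta: "(LINT t:{0..1}|lborel. complex_of_real (t ^ n * (1 - t) powr (b - 2))) = of_real (Beta (real n + 1) (b - 1))" for n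
  proof -
    have "((\<lambda>t. t powr (real n + 1 - 1) * (1 - t) powr (b - 1 - 1)) has_integral Beta (real n + 1) (b - 1)) {0..1}"
      by (rule has_integral_Beta_real) (use b in auto)
    then have "((\<lambda>t. t ^ n * (1 - t) powr (b - 2)) has_integral Beta (real n + 1) (b - 1)) {0..1}"
      \<comment> \<open>For \<open>n = 0\<close> the integrands differ at \<open>t = 0\<close>,
        where \<open>0 powr 0 = 0\<close> but \<open>0 ^ 0 = 1\<close>; a single point is
        negligible.\<close>
      by (rule has_integral_spike [of "{0}", rotated 2]) (auto simp: powr_realpow)
    moreover have "set_integrable lborel {0..1} (\<lambda>t. t ^ n * (1 - t) powr (b - 2))"
      by (intro borel_integrable_atLeastAtMost' continuous_intros cont1)
    ultimately have "(LINT t:{0..1}|lborel. t ^ n * (1 - t) powr (b - 2)) = Beta (real n + 1) (b - 1)"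
      by (simp add: set_borel_integral_eq_integral(2) integral_unique)
    then show ?thesis by (simp only: set_integral_complex_of_real)
  qed
  have int: "(LINT t:{0..1}|lborel. f N t) = (\<Sum>n<N. (z ^ n / fact n) * of_real (Beta (real n + 1) (b - 1)))" for N
  proof -
    have "(LINT t:{0..1}|lborel. f N t) = (\<Sum>n<N. LINT t:{0..1}|lborel. (z ^ n / fact n) * of_real (t ^ n * (1 - t) powr (b - 2)))"
      unfolding f_def set_lebesgue_integral_def scaleR_sum_right
      by (rule Bochner_Integration.integral_sum)
         (use borel_integrable_atLeastAtMost' [OF cont] in \<open>simp add: set_integrable_def\<close>)
    then show ?thesis by (simp only: set_integral_mult_right Beta)
  qed
  have coeff: "of_real (rGamma (b - 1)) * ((z ^ n / fact n) * of_real (Beta (real n + 1) (b - 1))) = of_real (rGamma (real n + b)) * z ^ n" for n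
  proof -
    have "rGamma (b - 1) * Beta (real n + 1) (b - 1) = fact n * rGamma (real n + b)"
    proof -
      have "Gamma (b - 1) > 0" using b by (intro Gamma_real_pos) simp
      then show ?thesis
        using Gamma_fact [of n, where 'a = real] by (simp add: less_imp_neq [symmetric] Beta_def rGamma_inverse_Gamma field_simps)
    qed
    then have "complex_of_real (rGamma (b - 1)) * of_real (Beta (real n + 1) (b - 1)) = fact n * of_real (rGamma (real n + b))"
      by (metis of_real_mult of_real_fact)
    then show ?thesis by (simp add: field_simps)
  qed
  note dc = set_dominated_convergence [where A = "{0..1}" and f = f and g = g
      and w = "\<lambda>t. exp (norm z) * (1 - t) powr (b - 2)" and v = "\<lambda>t. (1 - t) powr (b - 2)", OF _ _ lim _ bd]
  \<comment> \<open>Here \<open>Re z \<le> 0\<close> enters: \<open>exp (t * z)\<close> has norm at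
    most 1, so the majorant of the limit is free of \<open>z\<close>, unlike the one for the partial
    sums.\<close>
  have gbd: "norm (g t) \<le> (1 - t) powr (b - 2)" if "t \<in> {0..1}" for t
    using that z mult_nonneg_nonpos [of t "Re z"] by (simp add: g_def norm_mult mult_left_le_one_le)
  have "(\<lambda>N. of_real (rGamma (b - 1)) * (LINT t:{0..1}|lborel. f N t)) \<longlonglongrightarrow> of_real (rGamma (b - 1)) * (LINT t:{0..1}|lborel. g t)"
    by (intro tendsto_intros dc(1))
       (use gbd in \<open>auto simp: f_def intro!: borel_integrable_atLeastAtMost' continuous_intros cont cont1\<close>)
  then have "(\<lambda>n. of_real (rGamma (real n + b)) * z ^ n) sums (of_real (rGamma (b - 1)) * (LINT t:{0..1}|lborel. g t))"
    unfolding sums_def int sum_distrib_left coeff .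
  then have "mittag_leffler b z = of_real (rGamma (b - 1)) * (LINT t:{0..1}|lborel. g t)"
    by (simp add: mittag_leffler_def sums_iff)
  moreover have "norm (LINT t:{0..1}|lborel. g t) \<le> (LINT t:{0..1}|lborel. (1 - t) powr (b - 2))"
    by (intro dc(2))
       (use gbd in \<open>auto simp: f_def intro!: borel_integrable_atLeastAtMost' continuous_intros cont cont1\<close>)
  moreover have "rGamma (b - 1) \<ge> 0"
    using rGamma_nat_add_bounds(1) [of "b - 1" 0] b by simp
  ultimately show ?thesis
    by (simp add: norm_mult mult_left_mono)
qed

section \<open>Uniform boundedness of the two-parameter series\<close>

text \<open>Both \<open>b\<close> and \<open>\<mu>\<close> stay free because splitting off the first
  term moves them simultaneously, by 1 and by \<open>\<sigma>\<close>.\<close>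

definition struve_term :: "real \<Rightarrow> real \<Rightarrow> real \<Rightarrow> real \<Rightarrow> nat \<Rightarrow> real" where
  "struve_term \<sigma> b \<mu> x n = (- x) ^ n * (rGamma (real n + b) * rGamma (\<mu> - \<sigma> * real n))"

text \<open>The index enters only through an \<open>n\<close>-th power, so under the integral sign
  the series becomes a power series in \<open>- x * exp (\<sigma> * z)\<close>.\<close>

lemma hankel_fun_shift: "hankel_fun (\<mu> - \<sigma> * real n) z = hankel_fun \<mu> z * exp (of_real \<sigma> * z) ^ n"
  by (simp add: hankel_fun_def algebra_simps flip: exp_add exp_of_nat_mult)

lemma struve_series_bounded_base:
  assumes \<sigma>: "0 < \<sigma>" "\<sigma> < 1" and b: "b > 2"
  obtains C where "\<And>x. x \<ge> 0 \<Longrightarrow> summable (struve_term \<sigma> b \<mu> x)"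
    and "\<And>x. x \<ge> 0 \<Longrightarrow> \<bar>suminf (struve_term \<sigma> b \<mu> x)\<bar> \<le> C"
proof -
  \<comment> \<open>Three demands meet here: \<open>\<theta> > pi / 2\<close> for decay on the rays
    (possible as \<open>\<sigma> < 1\<close>), \<open>\<theta> \<le> pi\<close> for Hankel's
    formula, and \<open>\<sigma> * \<theta> \<le> pi / 2\<close> to keep
    \<open>- x * exp (\<sigma> * z)\<close> in the left half-plane.\<close>
  define \<theta> where "\<theta> = min pi (pi / (2 * \<sigma>))"
  have \<theta>: "pi / 2 < \<theta>" "\<theta> \<le> pi" and \<sigma>\<theta>: "\<sigma> * \<theta> \<le> pi / 2"
    using \<sigma> by (auto simp: \<theta>_def min_def field_simps)
  define M where "M = rGamma (b - 1) * (LINT t:{0..1}|lborel. (1 - t) powr (b - 2))"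
  \<comment> \<open>\<open>M\<close> bounds \<open>E\<close> on the half-plane, so this constant
    does not involve \<open>x\<close>; the divisor comes from the factor
    \<open>2 * pi * \<i>\<close> in Hankel's formula.\<close>
  define C where "C = hankel_mass \<theta> (\<lambda>z. M * norm (hankel_fun \<mu> z)) / (2 * pi)"
  have main: "struve_term \<sigma> b \<mu> x sums suminf (struve_term \<sigma> b \<mu> x) \<and> \<bar>suminf (struve_term \<sigma> b \<mu> x)\<bar> \<le> C" if x: "x \<ge> 0" for x
  proof -
    define \<zeta> where "\<zeta> = (\<lambda>z::complex. - of_real x * exp (of_real \<sigma> * z))"
    define f where "f = (\<lambda>N z. hankel_fun \<mu> z * (\<Sum>n<N. of_real (rGamma (real n + b)) * \<zeta> z ^ n))"
    define g where "g = (\<lambda>z. hankel_fun \<mu> z * mittag_leffler b (\<zeta> z))"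
    have \<zeta>_power: "\<zeta> z ^ n = (- of_real x) ^ n * exp (of_real \<sigma> * z) ^ n" for z n
      unfolding \<zeta>_def by (rule power_mult_distrib)
    have f_eq: "f N = (\<lambda>z. \<Sum>n<N. ((- of_real x) ^ n * of_real (rGamma (real n + b))) * hankel_fun (\<mu> - \<sigma> * real n) z)" for N
      by (simp add: f_def \<zeta>_power hankel_fun_shift sum_distrib_left mult_ac)
    have int_f: "hankel_integral \<theta> (f N) = 2 * \<i> * of_real pi * of_real (\<Sum>n<N. struve_term \<sigma> b \<mu> x n)" for N
      unfolding f_eq
      by (subst hankel_integral_sum_cmult)
         (auto simp: hankel_integrable_hankel_fun [OF \<theta>] hankel_integral_hankel_fun [OF \<theta>] struve_term_def sum_distrib_left mult_ac)
    have \<zeta>: "norm (\<zeta> z) = x * exp (\<sigma> * Re z)" for z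
      using x by (simp add: \<zeta>_def norm_mult)
    have Re_\<zeta>: "Re (\<zeta> z) \<le> 0" if "\<bar>Im z\<bar> \<le> \<theta>" for z
    proof -
      have "\<bar>\<sigma> * Im z\<bar> \<le> \<sigma> * \<theta>" using that \<sigma> by (simp add: abs_mult)
      then have "cos (\<sigma> * Im z) \<ge> 0" using \<sigma>\<theta> by (intro cos_ge_zero) auto
      then show ?thesis using x by (simp add: \<zeta>_def Re_exp)
    qed
    have fb: "norm (f N z) \<le> rGamma b * (norm (hankel_fun \<mu> z) * exp (x * exp (\<sigma> * Re z)))" for N z
      using mult_left_mono [OF mittag_leffler_partial_sum_bound [where b = b and N = N and z = "\<zeta> z"], of "norm (hankel_fun \<mu> z)"] b
      by (simp add: f_def norm_mult \<zeta> mult_ac)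
    have gb: "norm (g z) \<le> M * norm (hankel_fun \<mu> z)" if "\<bar>Im z\<bar> \<le> \<theta>" for z
      using mult_left_mono [OF mittag_leffler_bound [OF b Re_\<zeta> [OF that]], of "norm (hankel_fun \<mu> z)"]
      by (simp add: g_def norm_mult M_def mult_ac)
    have lim: "(\<lambda>N. f N z) \<longlonglongrightarrow> g z" for z
      unfolding f_def g_def using mittag_leffler_sums [of b "\<zeta> z"] b
      by (intro tendsto_intros) (auto simp: sums_def)
    have cont: "continuous_on UNIV (f N)" for N
      unfolding f_def \<zeta>_def by (intro continuous_intros)
    have cmult: "hankel_integrable \<theta> (\<lambda>z. k * h z)" if "hankel_integrable \<theta> h" for k :: real and h
      using that by (simp add: hankel_integrable_def)
    note dc = hankel_dominated_convergence [OF cont lim cmult [OF hankel_integrable_majorant [OF \<theta> \<sigma>(2)]] fb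
        cmult [OF hankel_integrable_norm_hankel_fun [OF \<theta>]] gb]
    define L where "L = hankel_integral \<theta> g / (2 * \<i> * of_real pi)"
    \<comment> \<open>Dominated convergence yields the convergence of the series as well as its
      value. Taking real parts afterwards returns to the real series.\<close>
    have "(\<lambda>N. hankel_integral \<theta> (f N) / (2 * \<i> * of_real pi)) \<longlonglongrightarrow> L"
      unfolding L_def using \<theta> pi_gt_zero by (intro tendsto_intros dc) auto
    then have "(\<lambda>N. complex_of_real (\<Sum>n<N. struve_term \<sigma> b \<mu> x n)) \<longlonglongrightarrow> L"
      by (simp add: int_f)
    then have "(\<lambda>N. Re (complex_of_real (\<Sum>n<N. struve_term \<sigma> b \<mu> x n))) \<longlonglongrightarrow> Re L"
      by (rule tendsto_Re)
    then have "struve_term \<sigma> b \<mu> x sums Re L" by (simp add: sums_def)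
    moreover have "\<bar>Re L\<bar> \<le> C"
    proof -
      have "\<bar>Re L\<bar> \<le> norm L" by (rule abs_Re_le_cmod)
      also have "\<dots> \<le> C"
        using dc(2) \<theta> pi_gt_zero by (simp add: L_def C_def norm_divide norm_mult divide_right_mono)
      finally show ?thesis .
    qed
    ultimately show ?thesis by (auto simp: sums_iff)
  qed
  show ?thesis using main that by (blast intro: sums_summable)
qed

text \<open>Lowering \<open>b\<close> costs a factor \<open>n + b - 1\<close>. The factor
  \<open>n\<close> is traded for a shift of the other parameter, since
  \<open>rGamma (\<mu> - 1 - \<sigma> * n)\<close> is \<open>\<mu> - 1 - \<sigma> * n\<close> times
  \<open>rGamma (\<mu> - \<sigma> * n)\<close>.\<close>

lemma struve_term_lower:
  assumes "\<sigma> \<noteq> 0"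
  shows "struve_term \<sigma> (b - 1) \<mu> x n =
    (b - 1 + (\<mu> - 1) / \<sigma>) * struve_term \<sigma> b \<mu> x n - struve_term \<sigma> b (\<mu> - 1) x n / \<sigma>"
proof -
  have 1: "rGamma (real n + (b - 1)) = (real n + (b - 1)) * rGamma (real n + b)"
    using rGamma_plus1 [of "real n + (b - 1)"] by (simp add: add_ac)
  have 2: "rGamma ((\<mu> - 1) - \<sigma> * real n) = (\<mu> - 1 - \<sigma> * real n) * rGamma (\<mu> - \<sigma> * real n)"
    using rGamma_plus1 [of "\<mu> - 1 - \<sigma> * real n"] by simp
  show ?thesis
    unfolding struve_term_def 1 2 using assms by (simp add: field_simps)
qed

text \<open>Every real parameter has the form \<open>b - j\<close> with \<open>b > 2\<close>, so
  this removes the restriction on \<open>b\<close>. The induction on \<open>j\<close> keeps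
  \<open>\<mu>\<close> arbitrary because each step uses both \<open>\<mu>\<close> and
  \<open>\<mu> - 1\<close>.\<close>

lemma struve_series_bounded:
  assumes \<sigma>: "0 < \<sigma>" "\<sigma> < 1" and b: "b > 2"
  obtains C where "\<And>x. x \<ge> 0 \<Longrightarrow> summable (struve_term \<sigma> (b - real j) \<mu> x)"
    and "\<And>x. x \<ge> 0 \<Longrightarrow> \<bar>suminf (struve_term \<sigma> (b - real j) \<mu> x)\<bar> \<le> C"
proof -
  have "\<exists>C. \<forall>x\<ge>0. summable (struve_term \<sigma> (b - real j) \<mu> x) \<and> \<bar>suminf (struve_term \<sigma> (b - real j) \<mu> x)\<bar> \<le> C"
  proof (induction j arbitrary: \<mu>)
    case 0
    show ?case using struve_series_bounded_base [OF assms, of \<mu>] by (metis diff_zero of_nat_0)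
  next
    case (Suc j)
    let ?b = "b - real j" and ?k = "b - real j - 1 + (\<mu> - 1) / \<sigma>"
    obtain C1 where C1: "\<forall>x\<ge>0. summable (struve_term \<sigma> ?b \<mu> x) \<and> \<bar>suminf (struve_term \<sigma> ?b \<mu> x)\<bar> \<le> C1"
      using Suc.IH [of \<mu>] by (elim exE)
    obtain C2 where C2: "\<forall>x\<ge>0. summable (struve_term \<sigma> ?b (\<mu> - 1) x) \<and> \<bar>suminf (struve_term \<sigma> ?b (\<mu> - 1) x)\<bar> \<le> C2"
      using Suc.IH [of "\<mu> - 1"] by (elim exE)
    have "summable (struve_term \<sigma> (?b - 1) \<mu> x) \<and> \<bar>suminf (struve_term \<sigma> (?b - 1) \<mu> x)\<bar> \<le> \<bar>?k\<bar> * C1 + C2 / \<sigma>"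
      if x: "x \<ge> 0" for x
    proof -
      have "(\<lambda>n. ?k * struve_term \<sigma> ?b \<mu> x n - struve_term \<sigma> ?b (\<mu> - 1) x n / \<sigma>) sums
         (?k * suminf (struve_term \<sigma> ?b \<mu> x) - suminf (struve_term \<sigma> ?b (\<mu> - 1) x) / \<sigma>)"
        using C1 C2 x by (intro sums_diff sums_mult sums_divide summable_sums) auto
      moreover have "struve_term \<sigma> (?b - 1) \<mu> x = (\<lambda>n. ?k * struve_term \<sigma> ?b \<mu> x n - struve_term \<sigma> ?b (\<mu> - 1) x n / \<sigma>)"
        using \<sigma> by (intro ext struve_term_lower) simp
      ultimately have s: "struve_term \<sigma> (?b - 1) \<mu> x sums
         (?k * suminf (struve_term \<sigma> ?b \<mu> x) - suminf (struve_term \<sigma> ?b (\<mu> - 1) x) / \<sigma>)"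
        by (simp only:)
      have "\<bar>?k * suminf (struve_term \<sigma> ?b \<mu> x)\<bar> \<le> \<bar>?k\<bar> * C1"
        unfolding abs_mult using C1 x by (intro mult_left_mono) auto
      moreover have "\<bar>suminf (struve_term \<sigma> ?b (\<mu> - 1) x) / \<sigma>\<bar> \<le> C2 / \<sigma>"
        unfolding abs_divide using C2 x \<sigma> by (simp add: divide_right_mono)
      ultimately have "\<bar>?k * suminf (struve_term \<sigma> ?b \<mu> x) - suminf (struve_term \<sigma> ?b (\<mu> - 1) x) / \<sigma>\<bar> \<le> \<bar>?k\<bar> * C1 + C2 / \<sigma>"
        by linarith
      then show ?thesis using s by (simp add: sums_iff)
    qed
    moreover have "b - real (Suc j) = ?b - 1" by simp
    ultimately show ?case by metis
  qed
  then show ?thesis using that by blast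
qed

section \<open>Exact expansion in inverse powers of \<open>x\<close>\<close>

text \<open>Without its first term, the series with parameters \<open>b\<close> and
  \<open>\<mu>\<close> is \<open>- x\<close> times the series with parameters \<open>b + 1\<close>
  and \<open>\<mu> - \<sigma>\<close>.\<close>

lemma struve_series_shift:
  assumes "summable (struve_term \<sigma> b \<mu> x)" "x \<noteq> 0"
  shows "suminf (struve_term \<sigma> (b + 1) (\<mu> - \<sigma>) x) = (rGamma b * rGamma \<mu> - suminf (struve_term \<sigma> b \<mu> x)) / x"
proof -
  have "struve_term \<sigma> b \<mu> x (Suc n) = - x * struve_term \<sigma> (b + 1) (\<mu> - \<sigma>) x n" for n
    by (simp add: struve_term_def algebra_simps)
  moreover have "struve_term \<sigma> b \<mu> x 0 = rGamma b * rGamma \<mu>"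
    by (simp add: struve_term_def)
  ultimately have "(\<Sum>n. - x * struve_term \<sigma> (b + 1) (\<mu> - \<sigma>) x n) = suminf (struve_term \<sigma> b \<mu> x) - rGamma b * rGamma \<mu>"
    and "summable (\<lambda>n. - x * struve_term \<sigma> (b + 1) (\<mu> - \<sigma>) x n)"
    using suminf_split_head [OF assms(1)] summable_Suc_iff [of "struve_term \<sigma> b \<mu> x"] assms(1) by simp_all
  moreover from this(2) have "summable (struve_term \<sigma> (b + 1) (\<mu> - \<sigma>) x)"
    using assms(2) summable_mult_D [of "- x"] by auto
  moreover from this have "(\<Sum>n. - x * struve_term \<sigma> (b + 1) (\<mu> - \<sigma>) x n) = - x * suminf (struve_term \<sigma> (b + 1) (\<mu> - \<sigma>) x)"
    by (intro suminf_mult)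
  ultimately have "x * suminf (struve_term \<sigma> (b + 1) (\<mu> - \<sigma>) x) = rGamma b * rGamma \<mu> - suminf (struve_term \<sigma> b \<mu> x)"
    by linarith
  then show ?thesis
    using assms(2) by (simp add: field_simps)
qed

text \<open>The shift identity iterated \<open>K\<close> times. No estimate enters: the remainder is
  again a series of the same family, at lowered parameter, over \<open>x ^ K\<close>.\<close>

lemma struve_series_expansion:
  assumes \<sigma>: "0 < \<sigma>" "\<sigma> < 1" and b: "b > 2" and x: "x > 0"
  shows "suminf (struve_term \<sigma> (b - real j) \<mu> x) =
    (\<Sum>k<K. (- 1) ^ k * rGamma (b - real j - real k - 1) * rGamma (\<mu> + \<sigma> * (real k + 1)) / x ^ (k + 1))
    + (- 1) ^ K * suminf (struve_term \<sigma> (b - real j - real K) (\<mu> + \<sigma> * real K) x) / x ^ K"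
proof (induction K)
  case (Suc K)
  have "summable (struve_term \<sigma> (b - real (j + K + 1)) (\<mu> + \<sigma> * real (Suc K)) x)"
    using struve_series_bounded [OF \<sigma> b] x by (metis less_imp_le)
  then have eq: "suminf (struve_term \<sigma> (b - real j - real K) (\<mu> + \<sigma> * real K) x) =
      (rGamma (b - real j - real K - 1) * rGamma (\<mu> + \<sigma> * (real K + 1))
        - suminf (struve_term \<sigma> (b - real j - real (Suc K)) (\<mu> + \<sigma> * real (Suc K)) x)) / x"
    using struve_series_shift [of \<sigma> "b - real (j + K + 1)" "\<mu> + \<sigma> * real (Suc K)" x] x
    by (simp add: algebra_simps)
  then show ?case
    unfolding Suc.IH eq by (simp add: diff_divide_distrib right_diff_distrib mult_ac)
qed simp

section \<open>Return to the Struve function\<close>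

text \<open>The square of \<open>\<i> * r / 2\<close> is the real number
  \<open>- (r / 2)\<^sup>2\<close>, so the series is real; the two principal powers have opposite
  exponents and a common nonzero base.\<close>

lemma gen_struve_imaginary_axis:
  assumes r: "r > 0" and sm: "summable (struve_term \<sigma> (3/2) (\<nu> + 3/2) ((r / 2)\<^sup>2))"
  shows "(\<i> * of_real r / 2) powr of_real (- \<nu> - 1) * gen_struve \<nu> (- \<sigma>) (\<i> * of_real r)
    = of_real (suminf (struve_term \<sigma> (3/2) (\<nu> + 3/2) ((r / 2)\<^sup>2)))"
proof -
  have "(\<i> * of_real r / 2) ^ (2 * n) * of_real (rGamma (real n + 3/2) * rGamma (- \<sigma> * real n + \<nu> + 3/2))
      = of_real (struve_term \<sigma> (3/2) (\<nu> + 3/2) ((r / 2)\<^sup>2) n)" for n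
  proof -
    have "(\<i> * of_real r / 2)\<^sup>2 = complex_of_real (- ((r / 2)\<^sup>2))"
      by (simp add: power_divide power_mult_distrib)
    then have "(\<i> * of_real r / 2) ^ (2 * n) = complex_of_real ((- ((r / 2)\<^sup>2)) ^ n)"
      by (simp only: power_mult of_real_power)
    moreover have "- \<sigma> * real n + \<nu> + 3/2 = \<nu> + 3/2 - \<sigma> * real n" by simp
    ultimately show ?thesis
      unfolding struve_term_def by (simp only: of_real_mult)
  qed
  then have "(\<Sum>n. (\<i> * of_real r / 2) ^ (2 * n) * complex_of_real (rGamma (real n + 3/2) * rGamma (- \<sigma> * real n + \<nu> + 3/2)))
      = of_real (suminf (struve_term \<sigma> (3/2) (\<nu> + 3/2) ((r / 2)\<^sup>2)))"
    by (simp only: suminf_of_real [OF sm])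
  moreover have "(\<i> * of_real r / 2) powr of_real (- \<nu> - 1) * (\<i> * of_real r / 2) powr of_real (\<nu> + 1) = 1"
    using r by (simp flip: powr_add)
  ultimately show ?thesis
    unfolding gen_struve_def by (simp flip: mult.assoc)
qed

text \<open>Reflection with \<open>sin (pi * (k + 1/2)) = (- 1) ^ k\<close>. It turns the
  alternating coefficients of the expansion into the positive ones of the claim, including the
  factor \<open>1 / pi\<close>.\<close>

lemma rGamma_half_minus_nat: "(- 1) ^ k * rGamma (1/2 - real k) = Gamma (real k + 1/2) / pi"
proof -
  have "sin (pi * (1 - (1/2 - real k))) = (- 1) ^ k"
    by (simp add: algebra_simps add_divide_distrib sin_add cos_npi)
  then have "(- 1) ^ k * Gamma (real k + 1/2) = pi * rGamma (1/2 - real k)"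
    using sin_rGamma_Gamma [of "1/2 - real k"] by (simp add: add.commute)
  then have "(- 1) ^ k * ((- 1) ^ k * Gamma (real k + 1/2)) = (- 1) ^ k * (pi * rGamma (1/2 - real k))"
    by simp
  then show ?thesis by (simp add: field_simps flip: power_mult_distrib)
qed

theorem theorem5:
  fixes \<nu> \<sigma> :: real
  assumes "0 < \<sigma>" and "\<sigma> < 1"
  shows "\<forall>K::nat. K \<ge> 1 \<longrightarrow>
    (\<lambda>r::real.
       (\<i> * complex_of_real r / 2) powr complex_of_real (- \<nu> - 1) *
         gen_struve \<nu> (- \<sigma>) (\<i> * complex_of_real r)
       - complex_of_real (1 / pi *
           (\<Sum>k<K. Gamma (real k + 1/2) * (r / 2) powi (- 2 * int k - 2) *
              rGamma (\<nu> + 3/2 + \<sigma> * (real k + 1)))))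
    \<in> O[at_top](\<lambda>r. complex_of_real (r powi (- 2 * int K - 2)))"
proof (intro allI impI)
  fix K :: nat
  define \<mu> where "\<mu> = \<nu> + 3/2"
  define F where "F = (\<lambda>r. suminf (struve_term \<sigma> (3/2) \<mu> ((r / 2)\<^sup>2)))"
  define c where "c = (\<lambda>k. (- 1) ^ k * rGamma (1/2 - real k) * rGamma (\<mu> + \<sigma> * (real k + 1)))"
  \<comment> \<open>The expansion is carried one term beyond the claim. After \<open>K + 1\<close>
    shifts from \<open>3/2\<close> the parameter is \<open>5/2 - (K + 2)\<close>, written from
    \<open>5/2 > 2\<close> so that the boundedness result applies.\<close>
  define R where "R = (\<lambda>r. (- 1) ^ Suc K * suminf (struve_term \<sigma> (5/2 - real (K + 2)) (\<mu> + \<sigma> * real (Suc K)) ((r / 2)\<^sup>2)))"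
  have pow: "(r / 2) powi (- 2 * int k - 2) = 1 / ((r / 2)\<^sup>2) ^ (k + 1)" for r :: real and k
  proof -
    have "- 2 * int k - 2 = - int (2 * (k + 1))" by simp
    then show ?thesis
      by (simp only: power_int_minus power_int_of_nat power_mult inverse_eq_divide)
  qed
  obtain C where C: "\<And>x. x \<ge> 0 \<Longrightarrow> \<bar>suminf (struve_term \<sigma> (5/2 - real (K + 2)) (\<mu> + \<sigma> * real (Suc K)) x)\<bar> \<le> C"
    by (rule struve_series_bounded [OF assms, of "5/2" "K + 2" "\<mu> + \<sigma> * real (Suc K)"]) (simp, blast)
  have lhs: "(\<i> * complex_of_real r / 2) powr complex_of_real (- \<nu> - 1) * gen_struve \<nu> (- \<sigma>) (\<i> * complex_of_real r)
       - complex_of_real (1 / pi * (\<Sum>k<K. Gamma (real k + 1/2) * (r / 2) powi (- 2 * int k - 2) *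
              rGamma (\<nu> + 3/2 + \<sigma> * (real k + 1)))) = of_real ((c K + R r) / ((r / 2)\<^sup>2) ^ (K + 1))"
    if r: "r > 0" for r
  proof -
    have "summable (struve_term \<sigma> (5/2 - real 1) \<mu> ((r / 2)\<^sup>2))"
      by (rule struve_series_bounded [OF assms, of "5/2" 1 \<mu>]) auto
    then have "(\<i> * complex_of_real r / 2) powr complex_of_real (- \<nu> - 1) * gen_struve \<nu> (- \<sigma>) (\<i> * complex_of_real r) = of_real (F r)"
      unfolding F_def \<mu>_def by (intro gen_struve_imaginary_axis r) simp
    \<comment> \<open>The term \<open>k = K\<close> and the remainder share the denominator
      \<open>((r / 2)\<^sup>2) ^ (K + 1)\<close>, which is exactly the required order; their
      numerators combine to the bounded quantity \<open>c K + R r\<close>.\<close>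
    moreover have "F r = (\<Sum>k<Suc K. c k / ((r / 2)\<^sup>2) ^ (k + 1)) + R r / ((r / 2)\<^sup>2) ^ (K + 1)"
      using struve_series_expansion [OF assms, of "5/2" "(r / 2)\<^sup>2" 1 \<mu> "Suc K"] r
      by (simp add: F_def R_def c_def algebra_simps)
    moreover have "1 / pi * (\<Sum>k<K. Gamma (real k + 1/2) * (r / 2) powi (- 2 * int k - 2) *
              rGamma (\<nu> + 3/2 + \<sigma> * (real k + 1))) = (\<Sum>k<K. c k / ((r / 2)\<^sup>2) ^ (k + 1))"
      unfolding sum_distrib_left pow c_def rGamma_half_minus_nat \<mu>_def
      by (intro sum.cong) (simp_all add: field_simps)
    ultimately show ?thesis by (simp add: add_divide_distrib)
  qed
  show "(\<lambda>r. (\<i> * complex_of_real r / 2) powr complex_of_real (- \<nu> - 1) * gen_struve \<nu> (- \<sigma>) (\<i> * complex_of_real r)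
       - complex_of_real (1 / pi * (\<Sum>k<K. Gamma (real k + 1/2) * (r / 2) powi (- 2 * int k - 2) *
              rGamma (\<nu> + 3/2 + \<sigma> * (real k + 1)))))
    \<in> O[at_top](\<lambda>r. complex_of_real (r powi (- 2 * int K - 2)))"
  proof (rule bigoI)
    show "\<forall>\<^sub>F r in at_top. norm ((\<i> * complex_of_real r / 2) powr complex_of_real (- \<nu> - 1) * gen_struve \<nu> (- \<sigma>) (\<i> * complex_of_real r)
       - complex_of_real (1 / pi * (\<Sum>k<K. Gamma (real k + 1/2) * (r / 2) powi (- 2 * int k - 2) *
              rGamma (\<nu> + 3/2 + \<sigma> * (real k + 1)))))
      \<le> ((\<bar>c K\<bar> + C) * 4 ^ (K + 1)) * norm (complex_of_real (r powi (- 2 * int K - 2)))"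
      using eventually_gt_at_top [of 0]
    proof eventually_elim
      case (elim r)
      \<comment> \<open>The bound is uniform in \<open>r\<close>; the factor
        \<open>4 ^ (K + 1)\<close> in the final constant comes from replacing
        \<open>(r / 2)\<^sup>2\<close> by \<open>r\<^sup>2\<close>.\<close>
      have "\<bar>c K + R r\<bar> \<le> \<bar>c K\<bar> + C"
        using abs_triangle_ineq [of "c K" "R r"] C [of "(r / 2)\<^sup>2"] by (simp add: R_def abs_mult)
      moreover have "((r / 2)\<^sup>2) ^ (K + 1) = (r\<^sup>2) ^ (K + 1) / 4 ^ (K + 1)"
        by (simp add: power_divide)
      moreover have "r powi (- 2 * int K - 2) = 1 / (r\<^sup>2) ^ (K + 1)"
        using pow [of "2 * r" K] by simp
      ultimately show ?case
        unfolding lhs [OF elim] norm_of_real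
        by (simp add: abs_mult mult_right_mono divide_right_mono)
    qed
  qed
qed

end
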